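(* Let $X$ be a countably infinite set. (a) Let $G$ be a finitely generated, countably infinite group. Then the following conditions are equivalent: (1) $G$ is LERF. (2) The set of finite index subgroups of $G$ is dense in $\mathrm{Sub}(G)$. (3) For a generic action $\sigma\in \mathrm{H}(G)$ of $G$ on $X$, all orbits are finite. (b) Let $G$ be a countably infinite group, not necessarily finitely generated. Then the following conditions are equivalent: (1) $G$ is LERF. (2) The set of finite index subgroups of $G$ is dense in $\mathrm{Sub}(G)$. (3') The set of actions $\sigma\in\mathrm{H}(G)$ of $G$ on $X$ all of whose orbits are finite is dense in $\mathrm{H}(G)$. Moreover, when these equivalent conditions hold, for a generic action $\sigma\in\mathrm{H}(G)$, every finitely generated subgroup $H<G$ has only finite orbits on $X$.
   Context: A group $G$ is LERF (locally extended residually finite, also called subgroup separable) if for every finitely generated subgroup $K\le G$ and every $g\in G\setminus K$ there is a finite index subgroup of $G$ that contains $K$ but does not contain $g$. $\mathrm{Sub}(G)$ is the space of all subgroups of $G$ with the Chabauty topology; for countable discrete $G$ a basis is given by the sets $\{K\in \mathrm{Sub}(G) : K\cap\Omega = H\cap\Omega\}$, with $H\in\mathrm{Sub}(G)$ and $\Omega\subseteq G$ finite. It is a compact metrizable space. $X!$ is the group of all permutations of $X$ with the topology of pointwise convergence, which has as a basis the sets $\{\tau\in X! : \tau a=\sigma a \text{ and } \tau^{-1}a=\sigma^{-1}a \text{ for all } a\in A\}$, with $\sigma\in X!$ and $A\subseteq X$ finite; it is a Polish group. $\mathrm{H}(G)=\mathrm{Hom}(G,X!)$ is the set of all actions (permutation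 representations) of $G$ on $X$, a closed subset of $(X!)^{G}$ with the product topology, hence a Polish space; a basis of its topology is given by the sets $\{\sigma\in \mathrm{H}(G) : \sigma(s)a=\varphi(s)a \text{ for all } s\in S,\ a\in A\}$, with $\varphi\in\mathrm{H}(G)$ and $S\subseteq G$, $A\subseteq X$ finite. A subset of a Baire space is generic if it contains a countable intersection of dense open sets. A property holds for a generic element of a Polish space (for instance, for a generic action, i.e. a generic element of $\mathrm{H}(G)$) if it holds for all elements of some generic subset. *)

theory Defs
  imports "HOL-Analysis.Analysis" "HOL-Algebra.Group_Action" "HOL-Algebra.Generated_Groups"
begin

definition fin_gen_subgroup :: "('g, 'b) monoid_scheme \<Rightarrow> 'g set \<Rightarrow> bool"
  where "fin_gen_subgroup G K \<longleftrightarrow> (\<exists>S. finite S \<and> S \<subseteq> carrier G \<and> K = generate G S)"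

definition fin_gen_group :: "('g, 'b) monoid_scheme \<Rightarrow> bool"
  where "fin_gen_group G \<longleftrightarrow> group G \<and> fin_gen_subgroup G (carrier G)"

definition fin_index_subgroup :: "('g, 'b) monoid_scheme \<Rightarrow> 'g set \<Rightarrow> bool"
  where "fin_index_subgroup G K \<longleftrightarrow> subgroup K G \<and> finite (rcosets\<^bsub>G\<^esub> K)"

definition LERF :: "('g, 'b) monoid_scheme \<Rightarrow> bool"
  where "LERF G \<longleftrightarrow> group G \<and>
    (\<forall>K g. fin_gen_subgroup G K \<and> g \<in> carrier G - K \<longrightarrow>
      (\<exists>L. fin_index_subgroup G L \<and> K \<subseteq> L \<and> g \<notin> L))"

definition chabauty :: "('g, 'b) monoid_scheme \<Rightarrow> 'g set topology"
  where "chabauty G = topology_generated_by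
    {{K. subgroup K G \<and> K \<inter> \<Omega> = H \<inter> \<Omega>} | H \<Omega>.
      subgroup H G \<and> finite \<Omega> \<and> \<Omega> \<subseteq> carrier G}"

text \<open>Pointwise convergence on the group of permutations of \<^term>\<open>X\<close>, requiring convergence
  of the inverses as well. Permutations are extensional functions, as in \<^const>\<open>BijGroup\<close>.\<close>

definition perm_topology :: "'x set \<Rightarrow> ('x \<Rightarrow> 'x) topology"
  where "perm_topology X = topology_generated_by
    {{\<tau> \<in> carrier (BijGroup X). \<forall>a\<in>A. \<tau> a = \<sigma> a \<and>
        (inv\<^bsub>BijGroup X\<^esub> \<tau>) a = (inv\<^bsub>BijGroup X\<^esub> \<sigma>) a} | \<sigma> A.
      \<sigma> \<in> carrier (BijGroup X) \<and> finite A \<and> A \<subseteq> X}"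

text \<open>The set \<^const>\<open>hom\<close> constrains homomorphisms only on the carrier; intersecting with
  \<^const>\<open>extensional\<close> makes each action be represented by exactly one function.\<close>

definition actions :: "('g, 'b) monoid_scheme \<Rightarrow> 'x set \<Rightarrow> ('g \<Rightarrow> 'x \<Rightarrow> 'x) set"
  where "actions G X = hom G (BijGroup X) \<inter> extensional (carrier G)"

definition action_topology ::
    "('g, 'b) monoid_scheme \<Rightarrow> 'x set \<Rightarrow> ('g \<Rightarrow> 'x \<Rightarrow> 'x) topology"
  where "action_topology G X =
    subtopology (product_topology (\<lambda>_. perm_topology X) (carrier G)) (actions G X)"

definition dense_in :: "'a topology \<Rightarrow> 'a set \<Rightarrow> bool"
  where "dense_in T A \<longleftrightarrow> A \<subseteq> topspace T \<and> T closure_of A = topspace T"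

definition generic_in :: "'a topology \<Rightarrow> 'a set \<Rightarrow> bool"
  where "generic_in T A \<longleftrightarrow> A \<subseteq> topspace T \<and>
    (\<exists>\<U>. countable \<U> \<and> (\<forall>U\<in>\<U>. openin T U \<and> dense_in T U) \<and> topspace T \<inter> \<Inter>\<U> \<subseteq> A)"

definition generically :: "'a topology \<Rightarrow> ('a \<Rightarrow> bool) \<Rightarrow> bool"
  where "generically T P \<longleftrightarrow> (\<exists>A. generic_in T A \<and> (\<forall>x\<in>A. P x))"

definition finite_orbits_on ::
    "('g, 'b) monoid_scheme \<Rightarrow> 'x set \<Rightarrow> 'g set \<Rightarrow> ('g \<Rightarrow> 'x \<Rightarrow> 'x) \<Rightarrow> bool"
  where "finite_orbits_on G X H \<sigma> \<longleftrightarrow> (\<forall>orb \<in> orbits (G\<lparr>carrier := H\<rparr>) X \<sigma>. finite orb)"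

abbreviation finite_orbits ::
    "('g, 'b) monoid_scheme \<Rightarrow> 'x set \<Rightarrow> ('g \<Rightarrow> 'x \<Rightarrow> 'x) \<Rightarrow> bool"
  where "finite_orbits G X \<sigma> \<equiv> (\<forall>orb \<in> orbits G X \<sigma>. finite orb)"

lemma topspace_chabauty: "topspace (chabauty G) = {H. subgroup H G}"
  by (auto simp: chabauty_def)

lemma topspace_perm_topology: "topspace (perm_topology X) = carrier (BijGroup X)"
  by (auto simp: perm_topology_def)

lemma topspace_action_topology: "topspace (action_topology G X) = actions G X"
  by (auto simp: action_topology_def actions_def topspace_perm_topology PiE_def hom_def)

lemma actions_imp_group_action:
  assumes "group G" "\<sigma> \<in> actions G X"
  shows "group_action G X \<sigma>"
  using assms group_BijGroup
  by (auto simp: actions_def group_action_def group_hom_def group_hom_axioms_def)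

end

theory Submission
  imports Defs
begin

text \<open>
  A basic neighbourhood, of a subgroup or of an action, records finitely many data, and each
  implication says that finitely many data can be realised by finite objects.

  For subgroups, the trace of a subgroup \<open>H\<close> on a finite set \<open>\<Omega>\<close> is also seen by the finitely
  generated subgroup \<open>\<langle>H \<inter> \<Omega>\<rangle>\<close>. Hence separating finitely generated subgroups from points by finite
  index subgroups amounts to density of the latter (\<open>LERF_iff_dense_fin_index\<close>).

  For actions, every action is a disjoint union of coset actions, and a neighbourhood only involves
  finitely many points. Replacing the stabilizers by finite index subgroups close to them produces
  a nearby action with finite orbits (\<open>dense_fin_index_imp_dense_finite_orbits\<close>). Conversely, an
  action with finite orbits near the coset action on \<open>G/K\<close> has a point stabilizer of finite index
  that contains the generators of \<open>K\<close> and omits a given element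
  (\<open>dense_finite_orbits_imp_LERF\<close>). In both directions coset spaces are transported to \<open>X\<close> and
  extended by fixed points, which is possible because \<open>X\<close> is infinite.

  For a finitely generated subgroup, finiteness of the orbit of a point is an open condition, and
  there are countably many such subgroups and points; so density of the actions with finite orbits
  makes all these conditions hold generically (\<open>generic_finite_orbits_on_fin_gen\<close>). If \<open>G\<close> itself is
  finitely generated, this covers the orbits of \<open>G\<close>. Generic sets of actions are dense
  (\<open>Baire_actions\<close>), which leads back from generic to dense.
\<close>

section \<open>Actions and their topology\<close>

lemma (in group) actionsI:
  assumes ext: "\<sigma> \<in> extensional (carrier G)"
    "\<And>g. g \<in> carrier G \<Longrightarrow> \<sigma> g \<in> extensional X"
    and closed: "\<And>g x. \<lbrakk>g \<in> carrier G; x \<in> X\<rbrakk> \<Longrightarrow> \<sigma> g x \<in> X"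
    and one: "\<And>x. x \<in> X \<Longrightarrow> \<sigma> \<one> x = x"
    and mult: "\<And>g h x. \<lbrakk>g \<in> carrier G; h \<in> carrier G; x \<in> X\<rbrakk> \<Longrightarrow> \<sigma> (g \<otimes> h) x = \<sigma> g (\<sigma> h x)"
  shows "\<sigma> \<in> actions G X"
proof -
  have cancel: "\<sigma> (inv g) (\<sigma> g x) = x" "\<sigma> g (\<sigma> (inv g) x) = x"
    if "g \<in> carrier G" "x \<in> X" for g x
    using mult[of "inv g" g x] mult[of g "inv g" x] one that by auto
  have Bij: "\<sigma> g \<in> Bij X" if g: "g \<in> carrier G" for g
  proof -
    have "bij_betw (\<sigma> g) X X"
      by (rule bij_betw_byWitness[where f' = "\<sigma> (inv g)"]) (use g closed cancel in auto)
    then show ?thesis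
      using ext(2)[OF g] by (simp add: Bij_def)
  qed
  have "\<sigma> (g \<otimes> h) = compose X (\<sigma> g) (\<sigma> h)" if "g \<in> carrier G" "h \<in> carrier G" for g h
    by (rule extensionalityI[of _ X]) (use that ext mult in \<open>auto simp: compose_def\<close>)
  then show ?thesis
    using Bij ext(1) by (auto simp: actions_def hom_def BijGroup_def)
qed

context
  fixes G :: "('g, 'b) monoid_scheme" (structure) and X :: "'x set" and \<sigma>
  assumes "group G" and \<sigma>: "\<sigma> \<in> actions G X"
begin

interpretation group_action G X \<sigma>
  by (rule actions_imp_group_action) fact+

interpretation group G by fact

lemma actions_closed: "\<lbrakk>g \<in> carrier G; x \<in> X\<rbrakk> \<Longrightarrow> \<sigma> g x \<in> X"
  using element_image by blast

lemma actions_one: "x \<in> X \<Longrightarrow> \<sigma> \<one> x = x"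
  using id_eq_one by (metis restrict_apply')

lemma actions_mult:
  "\<lbrakk>g \<in> carrier G; h \<in> carrier G; x \<in> X\<rbrakk> \<Longrightarrow> \<sigma> (g \<otimes> h) x = \<sigma> g (\<sigma> h x)"
  by (rule composition_rule)

lemma actions_inv_cancel: "\<lbrakk>g \<in> carrier G; x \<in> X\<rbrakk> \<Longrightarrow> \<sigma> (inv g) (\<sigma> g x) = x"
  using orbit_sym_aux by blast

lemma actions_cancel_inv: "\<lbrakk>g \<in> carrier G; x \<in> X\<rbrakk> \<Longrightarrow> \<sigma> g (\<sigma> (inv g) x) = x"
  using actions_inv_cancel[of "inv g" x] by simp

lemma actions_inj: "\<lbrakk>g \<in> carrier G; x \<in> X; y \<in> X; \<sigma> g x = \<sigma> g y\<rbrakk> \<Longrightarrow> x = y"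
  by (metis actions_inv_cancel)

lemma actions_in_BijGroup: "g \<in> carrier G \<Longrightarrow> \<sigma> g \<in> carrier (BijGroup X)"
  using bij_prop0 by (simp add: BijGroup_def)

lemma actions_inv: "g \<in> carrier G \<Longrightarrow> \<sigma> (inv g) = inv\<^bsub>BijGroup X\<^esub> \<sigma> g"
  using group_hom.hom_inv[OF group_hom] by simp

lemma actions_extensional: "\<sigma> \<in> extensional (carrier G)"
  "g \<in> carrier G \<Longrightarrow> \<sigma> g \<in> extensional X"
  using \<sigma> bij_prop0 by (auto simp: actions_def Bij_def)

end

text \<open>A basic neighbourhood of \<^term>\<open>\<phi>\<close>, the topology on actions being that of pointwise
  convergence of the maps \<open>(g, x) \<mapsto> \<sigma> g x\<close> into the discrete set \<open>X\<close>.\<close>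

definition cylinder ::
    "('g, 'b) monoid_scheme \<Rightarrow> 'x set \<Rightarrow> ('g \<Rightarrow> 'x \<Rightarrow> 'x) \<Rightarrow> 'g set \<Rightarrow> 'x set \<Rightarrow> ('g \<Rightarrow> 'x \<Rightarrow> 'x) set"
  where "cylinder G X \<phi> S A = {\<sigma> \<in> actions G X. \<forall>s\<in>S. \<forall>a\<in>A. \<sigma> s a = \<phi> s a}"

text \<open>The families generating the topologies of subgroups and of permutations are directed downwards
  at each point, so a single generator fits inside a given neighbourhood and no finite
  intersections occur.\<close>

lemma topology_generated_by_neighbourhood:
  assumes "openin (topology_generated_by \<B>) U" "x \<in> U"
    and directed: "\<And>B C. \<lbrakk>B \<in> \<B>; C \<in> \<B>; x \<in> B; x \<in> C\<rbrakk> \<Longrightarrow> \<exists>D\<in>\<B>. x \<in> D \<and> D \<subseteq> B \<inter> C"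
  shows "\<exists>B\<in>\<B>. x \<in> B \<and> B \<subseteq> U"
proof -
  have "generate_topology_on \<B> U"
    using assms(1) by (rule openin_topology_generated_by)
  then show ?thesis
    using assms(2)
  proof induction
    case (Int a b)
    then obtain B C where "B \<in> \<B>" "x \<in> B" "B \<subseteq> a" "C \<in> \<B>" "x \<in> C" "C \<subseteq> b"
      by blast
    then obtain D where "D \<in> \<B>" "x \<in> D" "D \<subseteq> B \<inter> C"
      using directed[of B C] by blast
    with \<open>B \<subseteq> a\<close> \<open>C \<subseteq> b\<close> show ?case
      by blast
  next
    case (Basis s)
    then show ?case by blast
  next
    case (UN K)
    then obtain k B where "k \<in> K" "B \<in> \<B>" "x \<in> B" "B \<subseteq> k"
      by (metis UnionE)
    then show ?case by blast
  qed simp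
qed

lemma perm_topology_neighbourhood:
  assumes "openin (perm_topology X) U" "\<tau> \<in> U"
  obtains A where "finite A" "A \<subseteq> X"
    "\<And>\<pi>. \<lbrakk>\<pi> \<in> carrier (BijGroup X);
        \<And>a. a \<in> A \<Longrightarrow> \<pi> a = \<tau> a \<and> (inv\<^bsub>BijGroup X\<^esub> \<pi>) a = (inv\<^bsub>BijGroup X\<^esub> \<tau>) a\<rbrakk> \<Longrightarrow> \<pi> \<in> U"
proof -
  define N where "N \<sigma> A = {\<tau> \<in> carrier (BijGroup X). \<forall>a\<in>A. \<tau> a = \<sigma> a \<and>
        (inv\<^bsub>BijGroup X\<^esub> \<tau>) a = (inv\<^bsub>BijGroup X\<^esub> \<sigma>) a}" for \<sigma> A
  define \<B> where "\<B> = {N \<sigma> A | \<sigma> A. \<sigma> \<in> carrier (BijGroup X) \<and> finite A \<and> A \<subseteq> X}"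
  have N_self: "\<tau> \<in> N \<tau> A" if "\<tau> \<in> N \<sigma> A'" for \<sigma> A A'
    using that by (simp add: N_def)
  have N_sub: "N \<tau> A \<subseteq> N \<sigma> A'" if "\<tau> \<in> N \<sigma> A'" "A' \<subseteq> A" for \<sigma> A A'
    using that unfolding N_def by fastforce
  have N_in: "N \<tau> A \<in> \<B>" if "\<tau> \<in> N \<sigma> A'" "finite A" "A \<subseteq> X" for \<sigma> A A'
    using that unfolding \<B>_def N_def by blast
  have "\<exists>B\<in>\<B>. \<tau> \<in> B \<and> B \<subseteq> U"
  proof (rule topology_generated_by_neighbourhood)
    show "openin (topology_generated_by \<B>) U"
      using assms(1) unfolding perm_topology_def \<B>_def N_def .
    show "\<tau> \<in> U" by fact
    fix B C assume "B \<in> \<B>" "C \<in> \<B>" and \<tau>: "\<tau> \<in> B" "\<tau> \<in> C"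
    then obtain \<sigma> A \<sigma>' A' where B: "B = N \<sigma> A" "finite A" "A \<subseteq> X"
      and C: "C = N \<sigma>' A'" "finite A'" "A' \<subseteq> X"
      unfolding \<B>_def by blast
    show "\<exists>D\<in>\<B>. \<tau> \<in> D \<and> D \<subseteq> B \<inter> C"
    proof (intro bexI conjI)
      show "N \<tau> (A \<union> A') \<in> \<B>"
        using N_in B C \<tau> by (metis Un_least finite_UnI)
      show "\<tau> \<in> N \<tau> (A \<union> A')" "N \<tau> (A \<union> A') \<subseteq> B \<inter> C"
        using N_self N_sub B C \<tau> by (metis, metis Int_greatest sup_ge1 sup_ge2)
    qed
  qed
  then obtain \<sigma> A where A: "finite A" "A \<subseteq> X" "\<tau> \<in> N \<sigma> A" "N \<sigma> A \<subseteq> U"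
    unfolding \<B>_def by blast
  show ?thesis
  proof (rule that[OF A(1,2)])
    fix \<pi> assume "\<pi> \<in> carrier (BijGroup X)"
      "\<And>a. a \<in> A \<Longrightarrow> \<pi> a = \<tau> a \<and> (inv\<^bsub>BijGroup X\<^esub> \<pi>) a = (inv\<^bsub>BijGroup X\<^esub> \<tau>) a"
    then have "\<pi> \<in> N \<tau> A"
      by (simp add: N_def)
    then show "\<pi> \<in> U"
      using N_sub[OF A(3) subset_refl] A(4) by blast
  qed
qed

lemma openin_perm_topology_evaluation:
  assumes "x \<in> X"
  shows "openin (perm_topology X) {\<tau> \<in> carrier (BijGroup X). \<tau> x = y}"
proof -
  have "\<exists>T. openin (perm_topology X) T \<and> \<tau> \<in> T \<and> T \<subseteq> {\<tau> \<in> carrier (BijGroup X). \<tau> x = y}"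
    if \<tau>: "\<tau> \<in> carrier (BijGroup X)" "\<tau> x = y" for \<tau>
  proof (intro exI conjI)
    let ?N = "{\<pi> \<in> carrier (BijGroup X). \<forall>a\<in>{x}. \<pi> a = \<tau> a \<and>
        (inv\<^bsub>BijGroup X\<^esub> \<pi>) a = (inv\<^bsub>BijGroup X\<^esub> \<tau>) a}"
    show "openin (perm_topology X) ?N"
      unfolding perm_topology_def
      by (intro topology_generated_by_Basis CollectI exI[of _ \<tau>] exI[of _ "{x}"])
        (use \<tau> assms in simp)
    show "\<tau> \<in> ?N" "?N \<subseteq> {\<tau> \<in> carrier (BijGroup X). \<tau> x = y}"
      using \<tau> by auto
  qed
  then show ?thesis
    by (intro iffD2[OF openin_subopen] ballI) (elim CollectE conjE)
qed

lemma openin_action_topology_evaluation: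
  assumes "g \<in> carrier G" "x \<in> X"
  shows "openin (action_topology G X) {\<sigma> \<in> actions G X. \<sigma> g x = y}"
proof -
  let ?P = "product_topology (\<lambda>_. perm_topology X) (carrier G)"
  have "openin ?P {\<sigma> \<in> topspace ?P. \<sigma> g \<in> {\<tau> \<in> carrier (BijGroup X). \<tau> x = y}}"
    by (rule openin_continuous_map_preimage[where Y = "perm_topology X"])
      (use assms in \<open>auto intro: continuous_map_product_projection openin_perm_topology_evaluation\<close>)
  moreover have "{\<sigma> \<in> actions G X. \<sigma> g x = y} =
      {\<sigma> \<in> topspace ?P. \<sigma> g \<in> {\<tau> \<in> carrier (BijGroup X). \<tau> x = y}} \<inter> actions G X"
    using assms by (auto simp: actions_def hom_def topspace_perm_topology PiE_def)
  ultimately show ?thesis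
    unfolding action_topology_def openin_subtopology by blast
qed

lemma openin_cylinder:
  assumes "finite S" "S \<subseteq> carrier G" "finite A" "A \<subseteq> X"
  shows "openin (action_topology G X) (cylinder G X \<phi> S A)"
proof -
  have "openin (action_topology G X)
      (topspace (action_topology G X) \<inter> (\<Inter>(s,a)\<in>S\<times>A. {\<sigma> \<in> actions G X. \<sigma> s a = \<phi> s a}))"
  proof (cases "S \<times> A = {}")
    case False
    then show ?thesis
      by (intro openin_Int openin_INT2)
        (use assms in \<open>auto intro!: openin_action_topology_evaluation\<close>)
  next
    case True
    then have "(\<Inter>(s,a)\<in>S\<times>A. {\<sigma> \<in> actions G X. \<sigma> s a = \<phi> s a}) = UNIV"
      by auto
    then show ?thesis by (simp only: Int_UNIV_right openin_topspace)
  qed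
  also have "topspace (action_topology G X) \<inter> (\<Inter>(s,a)\<in>S\<times>A. {\<sigma> \<in> actions G X. \<sigma> s a = \<phi> s a})
      = cylinder G X \<phi> S A"
    by (auto simp: cylinder_def topspace_action_topology)
  finally show ?thesis .
qed

text \<open>The permutation topology also controls inverses, but inverses of \<open>\<sigma> g\<close> are values of
  \<^term>\<open>\<sigma>\<close> at the inverse group element, so a cylinder may control them too.\<close>

lemma (in group) action_topology_neighbourhood:
  assumes "openin (action_topology G X) U" "\<phi> \<in> U"
  obtains S A where "finite S" "S \<subseteq> carrier G" "finite A" "A \<subseteq> X" "cylinder G X \<phi> S A \<subseteq> U"
proof -
  obtain V where V: "openin (product_topology (\<lambda>_. perm_topology X) (carrier G)) V"
    and U: "U = V \<inter> actions G X"
    using assms(1) unfolding action_topology_def openin_subtopology by blast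
  have \<phi>: "\<phi> \<in> actions G X" "\<phi> \<in> V"
    using U assms(2) by auto
  obtain W where fin: "finite {g \<in> carrier G. W g \<noteq> topspace (perm_topology X)}"
    and W: "\<And>g. g \<in> carrier G \<Longrightarrow> openin (perm_topology X) (W g)"
    and \<phi>W: "\<phi> \<in> Pi\<^sub>E (carrier G) W" and WV: "Pi\<^sub>E (carrier G) W \<subseteq> V"
    using bspec[OF V[unfolded openin_product_topology_alt] \<phi>(2)] by (elim exE conjE) blast
  define I where "I = {g \<in> carrier G. W g \<noteq> topspace (perm_topology X)}"
  have "\<exists>A. finite A \<and> A \<subseteq> X \<and> (\<forall>\<pi>\<in>carrier (BijGroup X).
      (\<forall>a\<in>A. \<pi> a = \<phi> g a \<and> (inv\<^bsub>BijGroup X\<^esub> \<pi>) a = (inv\<^bsub>BijGroup X\<^esub> (\<phi> g)) a) \<longrightarrow> \<pi> \<in> W g)"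
    if "g \<in> carrier G" for g
    using perm_topology_neighbourhood[OF W[OF that], of "\<phi> g"] PiE_mem[OF \<phi>W that]
    by metis
  then obtain A where A: "\<And>g. g \<in> carrier G \<Longrightarrow> finite (A g) \<and> A g \<subseteq> X \<and>
      (\<forall>\<pi>\<in>carrier (BijGroup X). (\<forall>a\<in>A g. \<pi> a = \<phi> g a \<and>
        (inv\<^bsub>BijGroup X\<^esub> \<pi>) a = (inv\<^bsub>BijGroup X\<^esub> (\<phi> g)) a) \<longrightarrow> \<pi> \<in> W g)"
    by metis
  have I: "finite I" "I \<subseteq> carrier G"
    using fin by (auto simp: I_def)
  show ?thesis
  proof (rule that)
    show "finite (I \<union> m_inv G ` I)" "I \<union> m_inv G ` I \<subseteq> carrier G"
      using I by auto
    show "finite (\<Union>g\<in>I. A g)" "(\<Union>g\<in>I. A g) \<subseteq> X"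
      using I A by blast+
    show "cylinder G X \<phi> (I \<union> m_inv G ` I) (\<Union>g\<in>I. A g) \<subseteq> U"
    proof
      fix \<sigma> assume \<sigma>: "\<sigma> \<in> cylinder G X \<phi> (I \<union> m_inv G ` I) (\<Union>g\<in>I. A g)"
      then have act: "\<sigma> \<in> actions G X"
        by (simp add: cylinder_def)
      have "\<sigma> g \<in> W g" if g: "g \<in> carrier G" for g
      proof (cases "g \<in> I")
        case True
        have "\<forall>a\<in>A g. \<sigma> g a = \<phi> g a \<and> \<sigma> (inv g) a = \<phi> (inv g) a"
          using \<sigma> True unfolding cylinder_def by blast
        then have "\<forall>a\<in>A g. \<sigma> g a = \<phi> g a \<and>
            (inv\<^bsub>BijGroup X\<^esub> (\<sigma> g)) a = (inv\<^bsub>BijGroup X\<^esub> (\<phi> g)) a"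
          using actions_inv[OF group_axioms act g] actions_inv[OF group_axioms \<phi>(1) g] by simp
        then show ?thesis
          using A[OF g] actions_in_BijGroup[OF group_axioms act g] by blast
      next
        case False
        then have "W g = carrier (BijGroup X)"
          using g by (simp add: I_def topspace_perm_topology)
        then show ?thesis
          using actions_in_BijGroup[OF group_axioms act g] by simp
      qed
      then have "\<sigma> \<in> Pi\<^sub>E (carrier G) W"
        using actions_extensional(1)[OF group_axioms act] by (auto simp: PiE_def)
      then show "\<sigma> \<in> U"
        using WV U act by blast
    qed
  qed
qed

lemma (in group) dense_in_action_topology_iff:
  assumes "D \<subseteq> actions G X"
  shows "dense_in (action_topology G X) D \<longleftrightarrow>
    (\<forall>\<phi> S A. \<phi> \<in> actions G X \<and> finite S \<and> S \<subseteq> carrier G \<and> finite A \<and> A \<subseteq> X \<longrightarrow>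
      D \<inter> cylinder G X \<phi> S A \<noteq> {})" (is "_ \<longleftrightarrow> ?R")
proof
  assume D: "dense_in (action_topology G X) D"
  show ?R
  proof (intro allI impI)
    fix \<phi> S A assume *: "\<phi> \<in> actions G X \<and> finite S \<and> S \<subseteq> carrier G \<and> finite A \<and> A \<subseteq> X"
    then have "cylinder G X \<phi> S A \<noteq> {}"
      by (auto simp: cylinder_def)
    moreover have "openin (action_topology G X) (cylinder G X \<phi> S A)"
      using * by (simp add: openin_cylinder)
    ultimately show "D \<inter> cylinder G X \<phi> S A \<noteq> {}"
      using D unfolding dense_in_def dense_intersects_open by simp
  qed
next
  assume R: ?R
  show "dense_in (action_topology G X) D"
    unfolding dense_in_def dense_intersects_open
  proof (intro conjI allI impI)
    show "D \<subseteq> topspace (action_topology G X)"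
      using assms by (simp add: topspace_action_topology)
    fix U assume U: "openin (action_topology G X) U \<and> U \<noteq> {}"
    then obtain \<phi> where "\<phi> \<in> U" by blast
    then have "\<phi> \<in> actions G X"
      using openin_subset[of "action_topology G X" U] U by (auto simp: topspace_action_topology)
    moreover obtain S A where "finite S" "S \<subseteq> carrier G" "finite A" "A \<subseteq> X"
        "cylinder G X \<phi> S A \<subseteq> U"
      by (rule action_topology_neighbourhood[OF conjunct1[OF U] \<open>\<phi> \<in> U\<close>])
    ultimately have "D \<inter> cylinder G X \<phi> S A \<noteq> {}"
      using R by simp
    with \<open>cylinder G X \<phi> S A \<subseteq> U\<close> show "D \<inter> U \<noteq> {}"
      by blast
  qed
qed

text \<open>As in the Baire category theorem, shrinking cylinders are chosen inside the given
  dense open sets, fixing more and more of the values \<open>\<sigma> g x\<close>; since \<open>G\<close> and \<open>X\<close> are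
  countable, every value is eventually fixed. The limit is an action because each instance of the
  action laws involves finitely many values only.\<close>

lemma (in group) Baire_actions:
  assumes "countable X" "X \<noteq> {}" "countable (carrier G)" "countable \<U>"
    and open_dense: "\<And>U. U \<in> \<U> \<Longrightarrow> openin (action_topology G X) U \<and> dense_in (action_topology G X) U"
  shows "dense_in (action_topology G X) (actions G X \<inter> \<Inter>\<U>)"
  unfolding dense_in_action_topology_iff[OF Int_lower1]
proof (intro allI impI)
  fix \<phi> S A
  assume start: "\<phi> \<in> actions G X \<and> finite S \<and> S \<subseteq> carrier G \<and> finite A \<and> A \<subseteq> X"
  let ?\<V> = "insert (actions G X) \<U>"
  have V: "openin (action_topology G X) U" "dense_in (action_topology G X) U" if "U \<in> ?\<V>" for U
    using that open_dense openin_topspace[of "action_topology G X"]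
      closure_of_topspace[of "action_topology G X"]
    by (auto simp: topspace_action_topology dense_in_def)
  define U where "U = from_nat_into ?\<V>"
  define e where "e = from_nat_into (carrier G)"
  define p where "p = from_nat_into X"
  have U: "range U = ?\<V>" and e: "range e = carrier G" and p: "range p = X"
    using assms(1-4) one_closed unfolding U_def e_def p_def
    by (auto intro!: range_from_nat_into simp del: one_closed)
  \<comment> \<open>A triple encodes a cylinder together with its centre.\<close>
  define good where "good = (\<lambda>(\<phi>, S, A). \<phi> \<in> actions G X \<and> finite S \<and> S \<subseteq> carrier G \<and> finite A \<and> A \<subseteq> X)"
  define refines where "refines = (\<lambda>n (\<phi>, S, A) (\<phi>', S', A').
    \<phi>' \<in> cylinder G X \<phi> S A \<and> S \<subseteq> S' \<and> A \<subseteq> A' \<and> cylinder G X \<phi>' S' A' \<subseteq> U n \<and> e n \<in> S' \<and> p n \<in> A')"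
  have step: "\<exists>c'. good c' \<and> refines n c c'" if "good c" for c n
  proof -
    obtain \<phi> S A where c: "c = (\<phi>, S, A)" by (cases c)
    have Un: "U n \<in> ?\<V>" using U by blast
    then have "U n \<subseteq> actions G X"
      using V(1) openin_subset topspace_action_topology by metis
    then have "U n \<inter> cylinder G X \<phi> S A \<noteq> {}"
      using V(2)[OF Un] that by (simp add: c good_def dense_in_action_topology_iff)
    then obtain \<psi> where \<psi>: "\<psi> \<in> U n" "\<psi> \<in> cylinder G X \<phi> S A"
      by blast
    obtain S' A' where SA: "finite S'" "S' \<subseteq> carrier G" "finite A'" "A' \<subseteq> X"
        "cylinder G X \<psi> S' A' \<subseteq> U n"
      by (rule action_topology_neighbourhood[OF V(1)[OF Un] \<psi>(1)])
    let ?S = "insert (e n) (S \<union> S')" and ?A = "insert (p n) (A \<union> A')"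
    have "cylinder G X \<psi> ?S ?A \<subseteq> cylinder G X \<psi> S' A'"
      by (auto simp: cylinder_def)
    moreover have "\<psi> \<in> actions G X"
      using \<psi> by (simp add: cylinder_def)
    ultimately have "good (\<psi>, ?S, ?A) \<and> refines n c (\<psi>, ?S, ?A)"
      using \<psi> SA that c e p by (auto simp: good_def refines_def)
    then show ?thesis by blast
  qed
  have "\<exists>f. \<forall>n. (good (f n) \<and> (n = 0 \<longrightarrow> f n = (\<phi>, S, A))) \<and> refines n (f n) (f (Suc n))"
    by (rule dependent_nat_choice) (use start step in \<open>auto simp: good_def\<close>)
  then obtain f where f: "\<And>n. good (f n)" "f 0 = (\<phi>, S, A)" "\<And>n. refines n (f n) (f (Suc n))"
    by blast
  define F SS AA where "F n = fst (f n)" and "SS n = fst (snd (f n))" and "AA n = snd (snd (f n))" for n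
  have F: "F n \<in> actions G X" and F_step: "F (Suc n) \<in> cylinder G X (F n) (SS n) (AA n)"
    and sub: "SS n \<subseteq> carrier G" "AA n \<subseteq> X"
    and mono_step: "SS n \<subseteq> SS (Suc n)" "AA n \<subseteq> AA (Suc n)"
    and enum: "e n \<in> SS (Suc n)" "p n \<in> AA (Suc n)"
    and in_U: "cylinder G X (F (Suc n)) (SS (Suc n)) (AA (Suc n)) \<subseteq> U n" for n
    using f(1)[of n] f(3)[of n] by (auto simp: good_def refines_def F_def SS_def AA_def split: prod.splits)
  have F0: "F 0 = \<phi>" "SS 0 = S" "AA 0 = A"
    using f(2) by (simp_all add: F_def SS_def AA_def)
  have mono: "SS m \<subseteq> SS n" "AA m \<subseteq> AA n" if "m \<le> n" for m n
    using lift_Suc_mono_le[of SS, OF mono_step(1) that] lift_Suc_mono_le[of AA, OF mono_step(2) that]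
    by auto
  have F_agree: "F n g x = F m g x" if "m \<le> n" "g \<in> SS m" "x \<in> AA m" for m n g x
    using that(1)
  proof (induction n rule: dec_induct)
    case (step n)
    have "g \<in> SS n" "x \<in> AA n"
      using mono[OF step(1)] that by auto
    then show ?case
      using F_step[of n] step by (simp add: cylinder_def)
  qed simp
  have covered: "\<exists>n. T \<subseteq> SS n \<and> B \<subseteq> AA n"
    if "finite T" "T \<subseteq> carrier G" "finite B" "B \<subseteq> X" for T B
  proof -
    have "\<exists>n. T \<subseteq> SS n"
      using that(1,2)
    proof (induction T)
      case (insert g T)
      then obtain n k where "T \<subseteq> SS n" "g = e k"
        using e by (metis imageE insert_subset)
      then have "insert g T \<subseteq> SS (max n (Suc k))"
        using mono(1)[of n "max n (Suc k)"] mono(1)[of "Suc k" "max n (Suc k)"] enum(1)[of k] by auto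
      then show ?case by blast
    qed simp
    moreover have "\<exists>n. B \<subseteq> AA n"
      using that(3,4)
    proof (induction B)
      case (insert x B)
      then obtain n k where "B \<subseteq> AA n" "x = p k"
        using p by (metis imageE insert_subset)
      then have "insert x B \<subseteq> AA (max n (Suc k))"
        using mono(2)[of n "max n (Suc k)"] mono(2)[of "Suc k" "max n (Suc k)"] enum(2)[of k] by auto
      then show ?case by blast
    qed simp
    ultimately obtain m n where "T \<subseteq> SS m" "B \<subseteq> AA n" by blast
    then have "T \<subseteq> SS (max m n) \<and> B \<subseteq> AA (max m n)"
      using mono(1)[of m "max m n"] mono(2)[of n "max m n"] by auto
    then show ?thesis by blast
  qed
  define N where "N g x = (LEAST n. g \<in> SS n \<and> x \<in> AA n)" for g x
  define \<sigma> where "\<sigma> = (\<lambda>g\<in>carrier G. \<lambda>x\<in>X. F (N g x) g x)"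
  have \<sigma>: "\<sigma> g x = F n g x" if "g \<in> SS n" "x \<in> AA n" for g x n
  proof -
    have "g \<in> SS (N g x) \<and> x \<in> AA (N g x)" "N g x \<le> n"
      unfolding N_def using that by (auto intro: LeastI2 Least_le)
    then show ?thesis
      using F_agree[of "N g x" n g x] sub[of n] that by (auto simp: \<sigma>_def)
  qed
  have "\<sigma> \<in> actions G X"
  proof (rule actionsI)
    show closed: "\<sigma> g x \<in> X" if gx: "g \<in> carrier G" "x \<in> X" for g x
    proof -
      obtain n where "g \<in> SS n" "x \<in> AA n"
        using covered[of "{g}" "{x}"] gx by auto
      then show ?thesis
        using \<sigma> actions_closed[OF group_axioms F gx] by simp
    qed
    show "\<sigma> \<one> x = x" if x: "x \<in> X" for x
    proof -
      obtain n where "\<one> \<in> SS n" "x \<in> AA n"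
        using covered[of "{\<one>}" "{x}"] x by auto
      then show ?thesis
        using \<sigma> actions_one[OF group_axioms F x] by simp
    qed
    show "\<sigma> (g \<otimes> h) x = \<sigma> g (\<sigma> h x)" if gx: "g \<in> carrier G" "h \<in> carrier G" "x \<in> X" for g h x
    proof -
      obtain n where "g \<in> SS n" "h \<in> SS n" "g \<otimes> h \<in> SS n" "x \<in> AA n" "\<sigma> h x \<in> AA n"
        using covered[of "{g, h, g \<otimes> h}" "{x, \<sigma> h x}"] gx closed by auto
      then show ?thesis
        using \<sigma> actions_mult[OF group_axioms F gx] by simp
    qed
  qed (auto simp: \<sigma>_def)
  then have \<sigma>_in: "\<sigma> \<in> cylinder G X (F n) (SS n) (AA n)" for n
    using \<sigma> by (simp add: cylinder_def)
  have "\<sigma> \<in> \<Inter>\<U>"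
  proof
    fix W assume "W \<in> \<U>"
    then obtain n where "W = U n"
      using U by blast
    then show "\<sigma> \<in> W"
      using in_U \<sigma>_in by blast
  qed
  then show "actions G X \<inter> \<Inter>\<U> \<inter> cylinder G X \<phi> S A \<noteq> {}"
    using \<sigma>_in[of 0] \<open>\<sigma> \<in> actions G X\<close> F0 by auto
qed

section \<open>Finite index subgroups and the Chabauty topology\<close>

lemma dense_in_chabauty_iff:
  assumes D: "\<And>K. K \<in> D \<Longrightarrow> subgroup K G"
  shows "dense_in (chabauty G) D \<longleftrightarrow>
    (\<forall>H \<Omega>. subgroup H G \<and> finite \<Omega> \<and> \<Omega> \<subseteq> carrier G \<longrightarrow> (\<exists>K\<in>D. K \<inter> \<Omega> = H \<inter> \<Omega>))" (is "_ \<longleftrightarrow> ?R")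
proof -
  define N where "N H \<Omega> = {K. subgroup K G \<and> K \<inter> \<Omega> = H \<inter> \<Omega>}" for H \<Omega>
  define \<B> where "\<B> = {N H \<Omega> | H \<Omega>. subgroup H G \<and> finite \<Omega> \<and> \<Omega> \<subseteq> carrier G}"
  have chabauty: "chabauty G = topology_generated_by \<B>"
    unfolding chabauty_def \<B>_def N_def ..
  have dense: "dense_in (chabauty G) D \<longleftrightarrow> (\<forall>U. openin (chabauty G) U \<and> U \<noteq> {} \<longrightarrow> D \<inter> U \<noteq> {})"
    using D dense_intersects_open[of "chabauty G" D] by (auto simp: dense_in_def topspace_chabauty)
  show ?thesis
  proof
    assume dns: "dense_in (chabauty G) D"
    show ?R
    proof (intro allI impI)
      fix H \<Omega> assume *: "subgroup H G \<and> finite \<Omega> \<and> \<Omega> \<subseteq> carrier G"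
      then have "openin (chabauty G) (N H \<Omega>)"
        unfolding chabauty by (intro topology_generated_by_Basis) (auto simp: \<B>_def)
      moreover have "N H \<Omega> \<noteq> {}"
        using * by (auto simp: N_def)
      ultimately have "D \<inter> N H \<Omega> \<noteq> {}"
        using dns dense by simp
      then show "\<exists>K\<in>D. K \<inter> \<Omega> = H \<inter> \<Omega>"
        by (auto simp: N_def)
    qed
  next
    assume R: ?R
    show "dense_in (chabauty G) D"
      unfolding dense
    proof (intro allI impI, elim conjE)
      fix U assume U: "openin (chabauty G) U" "U \<noteq> {}"
      then obtain H where H: "H \<in> U" by blast
      then have sub: "subgroup H G"
        using openin_subset[OF U(1)] by (auto simp: topspace_chabauty)
      have "\<exists>B\<in>\<B>. H \<in> B \<and> B \<subseteq> U"
      proof (rule topology_generated_by_neighbourhood)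
        show "openin (topology_generated_by \<B>) U"
          using U(1) by (simp add: chabauty)
        fix B C assume "B \<in> \<B>" "C \<in> \<B>" and HBC: "H \<in> B" "H \<in> C"
        then obtain H1 \<Omega> H2 \<Omega>' where B: "B = N H1 \<Omega>" "finite \<Omega>" "\<Omega> \<subseteq> carrier G"
          and C: "C = N H2 \<Omega>'" "finite \<Omega>'" "\<Omega>' \<subseteq> carrier G"
          unfolding \<B>_def by auto
        show "\<exists>D\<in>\<B>. H \<in> D \<and> D \<subseteq> B \<inter> C"
        proof (intro bexI conjI)
          show "N H (\<Omega> \<union> \<Omega>') \<in> \<B>"
            unfolding \<B>_def using B C sub by (intro CollectI exI[of _ H] exI[of _ "\<Omega> \<union> \<Omega>'"]) simp
          show "H \<in> N H (\<Omega> \<union> \<Omega>')"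
            using sub by (simp add: N_def)
          show "N H (\<Omega> \<union> \<Omega>') \<subseteq> B \<inter> C"
            using B(1) C(1) HBC unfolding N_def by blast
        qed
      qed (fact H)
      then obtain H' \<Omega> where *: "finite \<Omega>" "\<Omega> \<subseteq> carrier G" "H \<in> N H' \<Omega>" "N H' \<Omega> \<subseteq> U"
        unfolding \<B>_def by auto
      obtain K where "K \<in> D" "K \<inter> \<Omega> = H \<inter> \<Omega>"
        using R[rule_format, of H \<Omega>] sub * by auto
      then have "K \<in> N H' \<Omega>"
        using D *(3) by (simp add: N_def)
      then show "D \<inter> U \<noteq> {}"
        using \<open>K \<in> D\<close> *(4) by blast
    qed
  qed
qed

context group
begin

lemma fin_index_subgroup_carrier: "fin_index_subgroup G (carrier G)"
proof -
  have "rcosets (carrier G) \<subseteq> {carrier G}"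
    using coset_join2[OF _ subgroup_self] by (auto simp: RCOSETS_def)
  then show ?thesis
    unfolding fin_index_subgroup_def using subgroup_self finite_subset by blast
qed

lemma fin_index_subgroup_Int:
  assumes "fin_index_subgroup G K" "fin_index_subgroup G L"
  shows "fin_index_subgroup G (K \<inter> L)"
proof -
  have sub: "subgroup K G" "subgroup L G"
    using assms by (simp_all add: fin_index_subgroup_def)
  have "rcosets (K \<inter> L) \<subseteq> (\<lambda>(C, D). C \<inter> D) ` ((rcosets K) \<times> (rcosets L))"
  proof
    fix C assume "C \<in> rcosets (K \<inter> L)"
    then obtain g where g: "g \<in> carrier G" "C = (K \<inter> L) #> g"
      by (auto simp: RCOSETS_def)
    have KL: "subgroup (K \<inter> L) G"
      using sub by (rule subgroups_Inter_pair)
    have "C = (K #> g) \<inter> (L #> g)"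
      using subgroup.rcos_module[OF sub(1) is_group g(1)] subgroup.rcos_module[OF sub(2) is_group g(1)]
        subgroup.rcos_module[OF KL is_group g(1)] subgroup.elemrcos_carrier[OF sub(1) is_group g(1)]
        subgroup.elemrcos_carrier[OF KL is_group g(1)] unfolding g(2) by blast
    then show "C \<in> (\<lambda>(C, D). C \<inter> D) ` ((rcosets K) \<times> (rcosets L))"
      using g sub[THEN subgroup.subset] by (auto intro: rcosetsI)
  qed
  then have "finite (rcosets (K \<inter> L))"
    using assms by (auto simp: fin_index_subgroup_def intro: finite_subset)
  then show ?thesis
    using sub by (simp add: fin_index_subgroup_def subgroups_Inter_pair)
qed

text \<open>The factor \<^term>\<open>carrier G\<close> makes the intersection of the empty family a subgroup.\<close>

lemma fin_index_subgroup_Inter: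
  assumes "finite I" "\<And>i. i \<in> I \<Longrightarrow> fin_index_subgroup G (L i)"
  shows "fin_index_subgroup G (carrier G \<inter> (\<Inter>i\<in>I. L i))"
  using assms
proof induction
  case empty
  then show ?case by (simp add: fin_index_subgroup_carrier)
next
  case (insert i I)
  then have "fin_index_subgroup G (L i \<inter> (carrier G \<inter> (\<Inter>i\<in>I. L i)))"
    by (intro fin_index_subgroup_Int[of "L i"]) simp_all
  moreover have "L i \<inter> (carrier G \<inter> (\<Inter>i\<in>I. L i)) = carrier G \<inter> (\<Inter>i\<in>insert i I. L i)"
    by auto
  ultimately show ?case
    by simp
qed

text \<open>The part of \<open>H\<close> seen by a finite set \<open>\<Omega>\<close> generates a finitely generated group
  \<open>K \<le> H\<close>; separating \<open>K\<close> from the finitely many points of \<open>\<Omega> - H\<close> and intersecting gives a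
  finite index subgroup with the same trace on \<open>\<Omega>\<close>. Conversely, a finite index subgroup that
  agrees with \<open>K = \<langle>S\<rangle>\<close> on \<open>S \<union> {g}\<close> contains \<open>K\<close> and omits \<open>g\<close>.\<close>

theorem LERF_iff_dense_fin_index:
  "LERF G \<longleftrightarrow> dense_in (chabauty G) {K. fin_index_subgroup G K}"
proof -
  have dense: "dense_in (chabauty G) {K. fin_index_subgroup G K} \<longleftrightarrow>
      (\<forall>H \<Omega>. subgroup H G \<and> finite \<Omega> \<and> \<Omega> \<subseteq> carrier G \<longrightarrow>
        (\<exists>K\<in>{K. fin_index_subgroup G K}. K \<inter> \<Omega> = H \<inter> \<Omega>))"
    by (rule dense_in_chabauty_iff) (simp add: fin_index_subgroup_def)
  show ?thesis
    unfolding dense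
  proof (intro iffI allI impI)
    fix H \<Omega> assume lerf: "LERF G" and *: "subgroup H G \<and> finite \<Omega> \<and> \<Omega> \<subseteq> carrier G"
    have K: "fin_gen_subgroup G (generate G (H \<inter> \<Omega>))"
      using * unfolding fin_gen_subgroup_def by blast
    have KH: "generate G (H \<inter> \<Omega>) \<subseteq> H"
      using * by (simp add: generate_subgroup_incl)
    have "\<exists>L. fin_index_subgroup G L \<and> generate G (H \<inter> \<Omega>) \<subseteq> L \<and> g \<notin> L" if "g \<in> \<Omega> - H" for g
      using lerf K KH that * unfolding LERF_def by blast
    then obtain L where L: "\<And>g. g \<in> \<Omega> - H \<Longrightarrow>
        fin_index_subgroup G (L g) \<and> generate G (H \<inter> \<Omega>) \<subseteq> L g \<and> g \<notin> L g"
      by metis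
    let ?M = "carrier G \<inter> (\<Inter>g\<in>\<Omega> - H. L g)"
    have "fin_index_subgroup G ?M"
      using L * by (intro fin_index_subgroup_Inter) auto
    moreover have "?M \<inter> \<Omega> = H \<inter> \<Omega>"
    proof
      show "?M \<inter> \<Omega> \<subseteq> H \<inter> \<Omega>"
        using L by blast
      show "H \<inter> \<Omega> \<subseteq> ?M \<inter> \<Omega>"
        using L * generate.incl[of _ "H \<inter> \<Omega>" G] by blast
    qed
    ultimately show "\<exists>K\<in>{K. fin_index_subgroup G K}. K \<inter> \<Omega> = H \<inter> \<Omega>"
      by blast
  next
    assume R: "\<forall>H \<Omega>. subgroup H G \<and> finite \<Omega> \<and> \<Omega> \<subseteq> carrier G \<longrightarrow>
        (\<exists>K\<in>{K. fin_index_subgroup G K}. K \<inter> \<Omega> = H \<inter> \<Omega>)"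
    show "LERF G"
      unfolding LERF_def
    proof (intro conjI allI impI, rule is_group, elim conjE)
      fix K g assume "fin_gen_subgroup G K" and g: "g \<in> carrier G - K"
      then obtain S where S: "finite S" "S \<subseteq> carrier G" "K = generate G S"
        unfolding fin_gen_subgroup_def by blast
      have "subgroup K G"
        using S by (simp add: generate_is_subgroup)
      then obtain L where L: "fin_index_subgroup G L" "L \<inter> insert g S = K \<inter> insert g S"
        using R[rule_format, of K "insert g S"] S g by auto
      have "S \<subseteq> K"
        unfolding S(3) by (auto intro: generate.incl)
      then have "S \<subseteq> L \<inter> insert g S"
        unfolding L(2) by auto
      then have "S \<subseteq> L" by simp
      then have "K \<subseteq> L"
        unfolding S(3) using L(1) by (intro generate_subgroup_incl) (simp_all add: fin_index_subgroup_def)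
      moreover have "g \<notin> L"
        using L(2) g by (metis DiffD2 IntD1 IntI insertI1)
      ultimately show "\<exists>L. fin_index_subgroup G L \<and> K \<subseteq> L \<and> g \<notin> L"
        using L(1) by blast
    qed
  qed
qed

section \<open>Actions with prescribed coset orbits\<close>

text \<open>A coset of the stabilizer is determined by the point \<open>\<sigma> (inv g) x\<close> of the orbit, for any \<open>g\<close> in the
  coset.\<close>

lemma fin_index_stabilizer_of_finite_orbit:
  assumes \<sigma>: "\<sigma> \<in> actions G X" and x: "x \<in> X" and fin: "finite (orbit G \<sigma> x)"
  shows "fin_index_subgroup G (stabilizer G \<sigma> x)"
proof -
  interpret group_action G X \<sigma>
    by (rule actions_imp_group_action[OF is_group \<sigma>])
  have sub: "subgroup (stabilizer G \<sigma> x) G"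
    using x by (rule stabilizer_subgroup)
  have "rcosets (stabilizer G \<sigma> x) \<subseteq> (\<lambda>y. {k \<in> carrier G. \<sigma> (inv k) x = y}) ` orbit G \<sigma> x"
  proof
    fix C assume "C \<in> rcosets (stabilizer G \<sigma> x)"
    then obtain g where g: "g \<in> carrier G" "C = stabilizer G \<sigma> x #> g"
      by (auto simp: RCOSETS_def)
    have "k \<in> C \<longleftrightarrow> k \<in> carrier G \<and> \<sigma> (inv k) x = \<sigma> (inv g) x" for k
    proof (cases "k \<in> carrier G")
      case True
      have "k \<in> C \<longleftrightarrow> k \<otimes> inv g \<in> stabilizer G \<sigma> x"
        using subgroup.rcos_module[OF sub is_group g(1) True] g(2) by simp
      also have "\<dots> \<longleftrightarrow> \<sigma> k (\<sigma> (inv g) x) = x"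
        using True g x by (simp add: stabilizer_def composition_rule)
      also have "\<dots> \<longleftrightarrow> \<sigma> (inv g) x = \<sigma> (inv k) x"
        using actions_inv_cancel[OF is_group \<sigma> True, of "\<sigma> (inv g) x"]
          actions_cancel_inv[OF is_group \<sigma> True x] actions_closed[OF is_group \<sigma>, of "inv g" x] g x
        by auto
      finally show ?thesis
        using True by auto
    next
      case False
      then show ?thesis
        using g subgroup.elemrcos_carrier[OF sub is_group g(1)] by blast
    qed
    then have "C = {k \<in> carrier G. \<sigma> (inv k) x = \<sigma> (inv g) x}"
      by blast
    moreover have "\<sigma> (inv g) x \<in> orbit G \<sigma> x"
      using g by (auto simp: orbit_def)
    ultimately show "C \<in> (\<lambda>y. {k \<in> carrier G. \<sigma> (inv k) x = y}) ` orbit G \<sigma> x"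
      by blast
  qed
  then show ?thesis
    using sub fin finite_subset unfolding fin_index_subgroup_def by blast
qed

text \<open>Inversion turns right cosets into a left \<open>G\<close>-set: \<open>g \<mapsto> K g\<^sup>-\<^sup>1\<close> plays the role of the orbit map
  of the base point of \<open>G/K\<close>, and the lemma describes its fibres.\<close>

lemma rcos_inv_eq_iff:
  assumes K: "subgroup K G" and "g \<in> carrier G" "h \<in> carrier G"
  shows "K #> inv g = K #> inv h \<longleftrightarrow> inv h \<otimes> g \<in> K"
proof
  assume "K #> inv g = K #> inv h"
  then have "inv h \<in> K #> inv g"
    using rcos_self[of "inv h" K] assms by simp
  then show "inv h \<otimes> g \<in> K"
    using subgroup.rcos_module_imp[OF K is_group, of "inv g" "inv h"] assms by simp
next
  assume "inv h \<otimes> g \<in> K"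
  then have "inv h \<in> K #> inv g"
    using subgroup.rcos_module_rev[OF K is_group, of "inv g" "inv h"] assms by simp
  then show "K #> inv g = K #> inv h"
    using repr_independence K assms by simp
qed

end

text \<open>This places a countable model \<open>Y\<close> inside \<open>X\<close> with finitely many points in prescribed
  positions. The rest of \<open>Y\<close> goes into \<open>X - B\<close>, which is infinite.\<close>

lemma extend_to_bijection:
  assumes "infinite X" "finite B" "B \<subseteq> X" "countable Y" "inj_on j B" "j ` B \<subseteq> Y"
  obtains X0 h where "B \<subseteq> X0" "X0 \<subseteq> X" "bij_betw h X0 Y" "\<And>b. b \<in> B \<Longrightarrow> h b = j b"
proof -
  have "infinite (X - B)"
    using assms(1,2) by simp
  then obtain f :: "nat \<Rightarrow> 'a" where f: "inj f" "range f \<subseteq> X - B"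
    using infinite_countable_subset by blast
  define Z where "Z = Y - j ` B"
  define u where "u = f \<circ> to_nat_on Z"
  have "countable Z"
    using assms(4) by (simp add: Z_def)
  then have u: "inj_on u Z"
    unfolding u_def using f(1) by (intro comp_inj_on inj_on_to_nat_on) (auto intro: inj_on_subset)
  have uX: "u ` Z \<subseteq> X - B"
    using f(2) by (auto simp: u_def)
  define h where "h = (\<lambda>x. if x \<in> B then j x else inv_into Z u x)"
  have "bij_betw h B (j ` B)"
    using assms(5) by (auto simp: h_def bij_betw_def inj_on_def)
  moreover have "bij_betw h (u ` Z) Z \<longleftrightarrow> bij_betw (inv_into Z u) (u ` Z) Z"
    by (rule bij_betw_cong) (use uX in \<open>auto simp: h_def\<close>)
  then have "bij_betw h (u ` Z) Z"
    using u by (simp add: bij_betw_inv_into inj_on_imp_bij_betw)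
  moreover have "j ` B \<inter> Z = {}" "j ` B \<union> Z = Y"
    using assms(6) by (auto simp: Z_def)
  ultimately have "bij_betw h (B \<union> u ` Z) Y"
    using bij_betw_combine by fastforce
  then show ?thesis
    using uX assms(3) by (intro that[of "B \<union> u ` Z" h]) (auto simp: h_def)
qed

context group
begin

text \<open>A \<open>G\<close>-set \<open>Y\<close> in bijection with a part \<open>X0\<close> of \<open>X\<close> yields an action on all of \<open>X\<close>, with the
  points outside \<open>X0\<close> fixed.\<close>

lemma action_by_transport:
  assumes bij: "bij_betw h X0 Y" and sub: "X0 \<subseteq> X"
    and closed: "\<And>g y. \<lbrakk>g \<in> carrier G; y \<in> Y\<rbrakk> \<Longrightarrow> \<rho> g y \<in> Y"
    and one: "\<And>y. y \<in> Y \<Longrightarrow> \<rho> \<one> y = y"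
    and mult: "\<And>g k y. \<lbrakk>g \<in> carrier G; k \<in> carrier G; y \<in> Y\<rbrakk> \<Longrightarrow> \<rho> (g \<otimes> k) y = \<rho> g (\<rho> k y)"
  obtains \<sigma> where "\<sigma> \<in> actions G X"
    "\<And>g x. \<lbrakk>g \<in> carrier G; x \<in> X0\<rbrakk> \<Longrightarrow> \<sigma> g x \<in> X0"
    "\<And>g x. \<lbrakk>g \<in> carrier G; x \<in> X0\<rbrakk> \<Longrightarrow> h (\<sigma> g x) = \<rho> g (h x)"
    "\<And>g x. \<lbrakk>g \<in> carrier G; x \<in> X - X0\<rbrakk> \<Longrightarrow> \<sigma> g x = x"
proof -
  define k where "k = inv_into X0 h"
  have k: "k y \<in> X0" "h (k y) = y" if "y \<in> Y" for y
    using that bij by (auto simp: k_def bij_betw_def inv_into_into f_inv_into_f)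
  have h: "h x \<in> Y" "k (h x) = x" if "x \<in> X0" for x
    using that bij by (auto simp: k_def bij_betw_def)
  define \<sigma> where "\<sigma> = (\<lambda>g\<in>carrier G. \<lambda>x\<in>X. if x \<in> X0 then k (\<rho> g (h x)) else x)"
  have in0: "\<sigma> g x = k (\<rho> g (h x))" if "g \<in> carrier G" "x \<in> X0" for g x
    using that sub by (auto simp: \<sigma>_def)
  have out0: "\<sigma> g x = x" if "g \<in> carrier G" "x \<in> X - X0" for g x
    using that by (simp add: \<sigma>_def)
  have \<sigma>0: "\<sigma> g x \<in> X0" "h (\<sigma> g x) = \<rho> g (h x)" if "g \<in> carrier G" "x \<in> X0" for g x
    using that by (simp_all add: in0 k closed h)
  have "\<sigma> \<in> actions G X"
  proof (rule actionsI)
    show "\<sigma> g x \<in> X" if "g \<in> carrier G" "x \<in> X" for g x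
      using that \<sigma>0(1) out0 sub by (cases "x \<in> X0") auto
    show "\<sigma> \<one> x = x" if "x \<in> X" for x
      using that by (cases "x \<in> X0") (simp_all add: in0 out0 one h)
    show "\<sigma> (g \<otimes> g') x = \<sigma> g (\<sigma> g' x)" if "g \<in> carrier G" "g' \<in> carrier G" "x \<in> X" for g g' x
      using that by (cases "x \<in> X0") (simp_all add: in0 out0 mult h k closed)
  qed (auto simp: \<sigma>_def)
  then show ?thesis
    using that \<sigma>0 out0 by blast
qed

text \<open>The model transported here is the disjoint union of the coset spaces of subgroups \<open>K r\<close>, on
  which \<open>g\<close> acts by \<open>(r, C) \<mapsto> (r, C g\<^sup>-\<^sup>1)\<close>; the map \<open>j\<close> says where the points of \<open>B\<close> sit in it.\<close>

lemma action_with_coset_orbits: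
  fixes X :: "'x set" and K :: "'r \<Rightarrow> 'a set"
  assumes "infinite X" "finite B" "B \<subseteq> X"
    and K: "\<And>r. r \<in> R \<Longrightarrow> subgroup (K r) G"
    and "countable (SIGMA r:R. rcosets (K r))"
    and "inj_on j B" "j ` B \<subseteq> (SIGMA r:R. rcosets (K r))"
  obtains \<sigma> X0 h where "\<sigma> \<in> actions G X" "B \<subseteq> X0" "X0 \<subseteq> X"
    "bij_betw h X0 (SIGMA r:R. rcosets (K r))" "\<And>b. b \<in> B \<Longrightarrow> h b = j b"
    "\<And>g x. \<lbrakk>g \<in> carrier G; x \<in> X0\<rbrakk> \<Longrightarrow> \<sigma> g x \<in> X0"
    "\<And>g x. \<lbrakk>g \<in> carrier G; x \<in> X0\<rbrakk> \<Longrightarrow> h (\<sigma> g x) = (fst (h x), snd (h x) #> inv g)"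
    "\<And>g x. \<lbrakk>g \<in> carrier G; x \<in> X - X0\<rbrakk> \<Longrightarrow> \<sigma> g x = x"
proof -
  obtain X0 h where X0: "B \<subseteq> X0" "X0 \<subseteq> X" "bij_betw h X0 (SIGMA r:R. rcosets (K r))"
    "\<And>b. b \<in> B \<Longrightarrow> h b = j b"
    using extend_to_bijection[OF assms(1-3,5-7)] by metis
  have sub: "C \<subseteq> carrier G" if "r \<in> R" "C \<in> rcosets (K r)" for r C
    using subgroup.rcosets_carrier[OF K is_group] that by blast
  obtain \<sigma> where \<sigma>: "\<sigma> \<in> actions G X"
    "\<And>g x. \<lbrakk>g \<in> carrier G; x \<in> X0\<rbrakk> \<Longrightarrow> \<sigma> g x \<in> X0"
    "\<And>g x. \<lbrakk>g \<in> carrier G; x \<in> X0\<rbrakk> \<Longrightarrow> h (\<sigma> g x) = (fst (h x), snd (h x) #> inv g)"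
    "\<And>g x. \<lbrakk>g \<in> carrier G; x \<in> X - X0\<rbrakk> \<Longrightarrow> \<sigma> g x = x"
  proof (rule action_by_transport[OF X0(3,2), where \<rho> = "\<lambda>g y. (fst y, snd y #> inv g)"])
    show "(fst y, snd y #> inv g) \<in> (SIGMA r:R. rcosets (K r))"
      if g: "g \<in> carrier G" and y': "y \<in> (SIGMA r:R. rcosets (K r))" for g y
    proof -
      obtain r C where y: "y = (r, C)" "r \<in> R" "C \<in> rcosets (K r)"
        using y' by auto
      then obtain a where a: "a \<in> carrier G" "C = K r #> a"
        by (auto simp: RCOSETS_def)
      then have "C #> inv g = K r #> (a \<otimes> inv g)"
        using g subgroup.subset[OF K[OF y(2)]] by (simp add: coset_mult_assoc)
      then show ?thesis
        using y a g subgroup.subset[OF K[OF y(2)]] by (simp add: rcosetsI)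
    qed
    show "(fst y, snd y #> inv \<one>) = y" if "y \<in> (SIGMA r:R. rcosets (K r))" for y
      using that sub by auto
    show "(fst y, snd y #> inv (g \<otimes> k)) =
        (fst (fst y, snd y #> inv k), snd (fst y, snd y #> inv k) #> inv g)"
      if "g \<in> carrier G" "k \<in> carrier G" "y \<in> (SIGMA r:R. rcosets (K r))" for g k y
      using that sub by (auto simp: coset_mult_assoc inv_mult_group)
  qed blast
  show ?thesis
    by (rule that[OF \<sigma>(1) X0 \<sigma>(2-4)])
qed

lemma orbit_translate:
  assumes \<phi>: "\<phi> \<in> actions G X" and "g \<in> carrier G" "x \<in> X"
  shows "orbit G \<phi> (\<phi> g x) = orbit G \<phi> x"
proof
  show "orbit G \<phi> (\<phi> g x) \<subseteq> orbit G \<phi> x"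
    using assms actions_mult[OF is_group \<phi>, symmetric] by (auto simp: orbit_def)
  show "orbit G \<phi> x \<subseteq> orbit G \<phi> (\<phi> g x)"
  proof
    fix y assume "y \<in> orbit G \<phi> x"
    then obtain k where k: "k \<in> carrier G" "y = \<phi> k x"
      by (auto simp: orbit_def)
    then have "y = \<phi> (k \<otimes> inv g) (\<phi> g x)"
      using assms actions_mult[OF is_group \<phi>] actions_closed[OF is_group \<phi>]
        actions_inv_cancel[OF is_group \<phi>] by simp
    then show "y \<in> orbit G \<phi> (\<phi> g x)"
      using k(1) assms(2) by (auto simp: orbit_def)
  qed
qed

text \<open>A cylinder around \<open>\<phi>\<close> only sees the finite set \<open>B\<close> of points of \<open>A\<close> and their images under
  \<open>S\<close>. With a base point \<open>r\<close> in each orbit meeting \<open>B\<close> and elements \<open>f b\<close> carrying the base point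
  to \<open>b\<close>, the relation \<open>\<phi> s b = b'\<close> says that \<open>(f b')\<^sup>-\<^sup>1 s (f b)\<close> lies in the stabilizer of \<open>r\<close>. Only
  finitely many group elements \<open>\<Omega>\<close> occur in this way, so the stabilizers may be replaced by finite
  index subgroups \<open>K r\<close> with the same trace on \<open>\<Omega>\<close>: in the finite \<open>G\<close>-set formed by the coset
  spaces of the \<open>K r\<close>, the points \<open>(f b) K\<close> are related by \<open>S\<close> exactly as the points \<open>b\<close> are in
  \<open>X\<close>. Transporting that \<open>G\<close>-set to \<open>X\<close> along \<open>B\<close> gives an action in the cylinder with finite orbits.\<close>

theorem dense_fin_index_imp_dense_finite_orbits:
  fixes X :: "'x set"
  assumes X: "infinite X" and dense: "dense_in (chabauty G) {K. fin_index_subgroup G K}"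
  shows "dense_in (action_topology G X) {\<sigma> \<in> actions G X. finite_orbits G X \<sigma>}"
proof (subst dense_in_action_topology_iff; (intro allI impI; elim conjE)?)
  show "{\<sigma> \<in> actions G X. finite_orbits G X \<sigma>} \<subseteq> actions G X"
    by blast
  fix \<phi> S A
  assume \<phi>: "\<phi> \<in> actions G X" and S: "finite S" "S \<subseteq> carrier G" and A: "finite A" "A \<subseteq> X"
  note act = actions_closed[OF is_group \<phi>] actions_one[OF is_group \<phi>] actions_mult[OF is_group \<phi>]
    actions_inv_cancel[OF is_group \<phi>] actions_cancel_inv[OF is_group \<phi>]
  define B where "B = A \<union> (\<Union>s\<in>S. \<phi> s ` A)"
  have B: "finite B" "B \<subseteq> X"
    using S A act(1) by (auto simp: B_def)
  \<comment> \<open>A base point of the orbit of \<open>b\<close>; it depends on the orbit only.\<close>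
  define c where "c b = (SOME y. y \<in> orbit G \<phi> b)" for b
  have c_translate: "c (\<phi> g b) = c b" if "g \<in> carrier G" "b \<in> X" for g b
    using orbit_translate[OF \<phi> that] by (simp add: c_def)
  have "\<exists>g. g \<in> carrier G \<and> \<phi> g (c b) = b \<and> c b \<in> X" if b: "b \<in> X" for b
  proof -
    have "\<phi> \<one> b \<in> orbit G \<phi> b"
      unfolding orbit_def by blast
    then have "c b \<in> orbit G \<phi> b"
      unfolding c_def by (rule someI)
    then obtain k where "k \<in> carrier G" "c b = \<phi> k b"
      by (auto simp: orbit_def)
    then show ?thesis
      using act b by (intro exI[of _ "inv k"]) simp
  qed
  then obtain f where f: "\<And>b. b \<in> X \<Longrightarrow> f b \<in> carrier G \<and> \<phi> (f b) (c b) = b \<and> c b \<in> X"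
    by metis
  define \<Omega> where "\<Omega> = (\<lambda>(b', s, b). inv (f b') \<otimes> (s \<otimes> f b)) ` (B \<times> insert \<one> S \<times> B)"
  have fB: "f b \<in> carrier G" if "b \<in> B" for b
    using f that B(2) by auto
  have \<Omega>: "finite \<Omega>" "\<Omega> \<subseteq> carrier G"
    using B(1) S fB by (auto simp: \<Omega>_def intro!: m_closed)
  have stab: "subgroup (stabilizer G \<phi> r) G" if "r \<in> X" for r
    using group_action.stabilizer_subgroup[OF actions_imp_group_action[OF is_group \<phi>] that] .
  have "\<exists>K. fin_index_subgroup G K \<and> K \<inter> \<Omega> = stabilizer G \<phi> r \<inter> \<Omega>" if "r \<in> X" for r
  proof -
    have "\<forall>H \<Omega>. subgroup H G \<and> finite \<Omega> \<and> \<Omega> \<subseteq> carrier G \<longrightarrow>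
        (\<exists>K\<in>{K. fin_index_subgroup G K}. K \<inter> \<Omega> = H \<inter> \<Omega>)"
      using dense by (subst (asm) dense_in_chabauty_iff) (simp_all add: fin_index_subgroup_def)
    then show ?thesis
      using stab[OF that] \<Omega> by auto
  qed
  then obtain K where K: "\<And>r. r \<in> X \<Longrightarrow> fin_index_subgroup G (K r)"
    and K\<Omega>: "\<And>r. r \<in> X \<Longrightarrow> K r \<inter> \<Omega> = stabilizer G \<phi> r \<inter> \<Omega>"
    by metis
  have Ksub: "subgroup (K r) G" if "r \<in> X" for r
    using K[OF that] by (simp add: fin_index_subgroup_def)
  \<comment> \<open>Taking \<open>s = \<one>\<close> will show that the images of the points of \<open>B\<close> in the model are distinct.\<close>
  have key: "inv (f b') \<otimes> (s \<otimes> f b) \<in> K (c b) \<longleftrightarrow> \<phi> s b = b'"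
    if "b \<in> B" "b' \<in> B" "s \<in> insert \<one> S" "c b' = c b" for b b' s
  proof -
    have X: "b \<in> X" "b' \<in> X" and s: "s \<in> carrier G"
      using that B S by auto
    have "inv (f b') \<otimes> (s \<otimes> f b) \<in> \<Omega>"
      unfolding \<Omega>_def using that by force
    then have "inv (f b') \<otimes> (s \<otimes> f b) \<in> K (c b) \<longleftrightarrow>
        inv (f b') \<otimes> (s \<otimes> f b) \<in> stabilizer G \<phi> (c b)"
      using K\<Omega>[of "c b"] f[OF X(1)] by blast
    also have "\<dots> \<longleftrightarrow> \<phi> (inv (f b')) (\<phi> s b) = c b"
      using f[OF X(1)] f[OF X(2)] s X act by (simp add: stabilizer_def)
    also have "\<dots> \<longleftrightarrow> \<phi> s b = b'"
      using f[OF X(1)] f[OF X(2)] s X act that(4) by metis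
    finally show ?thesis .
  qed
  define j where "j b = (c b, K (c b) #> inv (f b))" for b
  let ?Y = "SIGMA r:c ` B. rcosets (K r)"
  have inj: "inj_on j B"
  proof (rule inj_onI)
    fix b b' assume b: "b \<in> B" "b' \<in> B" and j_eq: "j b = j b'"
    then have c: "c b' = c b"
      by (simp add: j_def)
    then have "K (c b) #> inv (f b) = K (c b) #> inv (f b')"
      using j_eq by (simp add: j_def)
    then have "inv (f b') \<otimes> f b \<in> K (c b)"
      using rcos_inv_eq_iff[OF Ksub[of "c b"] fB fB] b f[of b] B(2) by auto
    then have "\<phi> \<one> b = b'"
      using key[OF b _ c, of \<one>] fB[OF b(1)] by simp
    then show "b = b'"
      using act(2) b B(2) by auto
  qed
  have jY: "j ` B \<subseteq> ?Y"
  proof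
    fix y assume "y \<in> j ` B"
    then obtain b where b: "b \<in> B" "y = j b"
      by blast
    then have "K (c b) #> inv (f b) \<in> rcosets (K (c b))"
      using f[of b] B(2) subgroup.subset[OF Ksub[of "c b"]] by (intro rcosetsI) auto
    then show "y \<in> ?Y"
      using b by (auto simp: j_def)
  qed
  have cX: "c ` B \<subseteq> X"
    using f B(2) by auto
  have Y: "finite ?Y"
    using B(1) K cX by (intro finite_SigmaI) (auto simp: fin_index_subgroup_def)
  obtain \<sigma> X0 h where \<sigma>: "\<sigma> \<in> actions G X" and X0: "B \<subseteq> X0" "X0 \<subseteq> X"
    and h: "bij_betw h X0 ?Y" "\<And>b. b \<in> B \<Longrightarrow> h b = j b"
    and \<sigma>_in: "\<And>g x. \<lbrakk>g \<in> carrier G; x \<in> X0\<rbrakk> \<Longrightarrow> \<sigma> g x \<in> X0"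
    and \<sigma>_h: "\<And>g x. \<lbrakk>g \<in> carrier G; x \<in> X0\<rbrakk> \<Longrightarrow> h (\<sigma> g x) = (fst (h x), snd (h x) #> inv g)"
    and \<sigma>_out: "\<And>g x. \<lbrakk>g \<in> carrier G; x \<in> X - X0\<rbrakk> \<Longrightarrow> \<sigma> g x = x"
  proof (rule action_with_coset_orbits[OF X B _ countable_finite[OF Y] inj jY])
    show "subgroup (K r) G" if "r \<in> c ` B" for r
      using Ksub cX that by blast
  qed (rule that)
  have "finite X0"
    using h(1) Y bij_betw_finite by blast
  have "finite (orbit G \<sigma> x)" if "x \<in> X" for x
  proof (cases "x \<in> X0")
    case True
    then have "orbit G \<sigma> x \<subseteq> X0"
      using \<sigma>_in by (auto simp: orbit_def)
    then show ?thesis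
      using \<open>finite X0\<close> finite_subset by blast
  next
    case False
    then have "orbit G \<sigma> x \<subseteq> {x}"
      using \<sigma>_out that by (auto simp: orbit_def)
    then show ?thesis
      using finite_subset by blast
  qed
  then have "finite_orbits G X \<sigma>"
    by (auto simp: orbits_def)
  moreover have "\<sigma> s a = \<phi> s a" if "s \<in> S" "a \<in> A" for s a
  proof -
    have s: "s \<in> carrier G" and aB: "a \<in> B" "\<phi> s a \<in> B"
      using that S by (auto simp: B_def)
    then have X: "a \<in> X" "\<phi> s a \<in> X"
      using B(2) by auto
    have cs: "c (\<phi> s a) = c a"
      using c_translate s X by simp
    note fa = f[OF X(1)] and fs = f[OF X(2)]
    have "inv (f (\<phi> s a)) \<otimes> (s \<otimes> f a) \<in> K (c a)"
      using key[OF aB _ cs, of s] that by simp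
    then have "K (c a) #> inv (s \<otimes> f a) = K (c a) #> inv (f (\<phi> s a))"
      using rcos_inv_eq_iff[OF Ksub[of "c a"], of "s \<otimes> f a" "f (\<phi> s a)"] fa fs s by simp
    moreover have "K (c a) #> inv (s \<otimes> f a) = K (c a) #> inv (f a) #> inv s"
      using fa s subgroup.subset[OF Ksub[of "c a"]] by (simp add: coset_mult_assoc inv_mult_group)
    ultimately have "h (\<sigma> s a) = h (\<phi> s a)"
      using \<sigma>_h[OF s] h(2) aB X0(1) cs by (auto simp: j_def)
    then show ?thesis
      using h(1) \<sigma>_in[OF s] aB X0(1) unfolding bij_betw_def inj_on_def by blast
  qed
  ultimately show "{\<sigma> \<in> actions G X. finite_orbits G X \<sigma>} \<inter> cylinder G X \<phi> S A \<noteq> {}"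
    using \<sigma> unfolding cylinder_def by blast
qed

text \<open>In the coset action of \<open>G\<close> on \<open>G/K\<close>, extended to \<open>X\<close> by fixed points, the base point \<open>x\<close> has
  stabilizer \<open>K = \<langle>S\<rangle>\<close>. A nearby action with finite orbits still lets \<open>S\<close> fix \<open>x\<close> and \<open>g\<close> move it;
  its stabilizer of \<open>x\<close> is the finite index subgroup sought.\<close>

theorem dense_finite_orbits_imp_LERF:
  fixes X :: "'x set"
  assumes X: "infinite X" and G: "countable (carrier G)"
    and dense: "dense_in (action_topology G X) {\<sigma> \<in> actions G X. finite_orbits G X \<sigma>}"
  shows "LERF G"
  unfolding LERF_def
proof (intro conjI allI impI, rule is_group, elim conjE)
  fix K g assume "fin_gen_subgroup G K" and g: "g \<in> carrier G - K"
  then obtain S where S: "finite S" "S \<subseteq> carrier G" "K = generate G S"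
    unfolding fin_gen_subgroup_def by blast
  have K: "subgroup K G"
    using S by (simp add: generate_is_subgroup)
  have "rcosets K = (\<lambda>a. K #> a) ` carrier G"
    by (auto simp: RCOSETS_def)
  then have cnt: "countable (SIGMA r:{()}. rcosets K)"
    using G by (intro countable_SIGMA) auto
  obtain \<phi> X0 h where \<phi>: "\<phi> \<in> actions G X" and X0: "X0 \<subseteq> X"
    and h: "bij_betw h X0 (SIGMA r:{()}. rcosets K)"
    and \<phi>_in: "\<And>g x. \<lbrakk>g \<in> carrier G; x \<in> X0\<rbrakk> \<Longrightarrow> \<phi> g x \<in> X0"
    and \<phi>_h: "\<And>g x. \<lbrakk>g \<in> carrier G; x \<in> X0\<rbrakk> \<Longrightarrow> h (\<phi> g x) = (fst (h x), snd (h x) #> inv g)"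
  proof (rule action_with_coset_orbits[OF X finite.emptyI empty_subsetI K cnt])
    show "inj_on (\<lambda>_. undefined) {}" "(\<lambda>_. undefined) ` {} \<subseteq> (SIGMA r:{()}. rcosets K)"
      by simp_all
  qed (rule that)
  have "K #> \<one> \<in> rcosets K"
    using subgroup.subset[OF K] by (intro rcosetsI) auto
  then have "((), K) \<in> h ` X0"
    using h subgroup.subset[OF K] by (simp add: bij_betw_def)
  then obtain x where x: "x \<in> X0" "h x = ((), K)"
    by auto
  have fixes_iff: "\<phi> k x = x \<longleftrightarrow> k \<in> K" if k: "k \<in> carrier G" for k
  proof -
    have "\<phi> k x = x \<longleftrightarrow> h (\<phi> k x) = h x"
      using h \<phi>_in[OF k x(1)] x(1) by (auto simp: bij_betw_def inj_on_def)
    also have "\<dots> \<longleftrightarrow> K #> inv k = K #> inv \<one>"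
      using \<phi>_h[OF k x(1)] x(2) subgroup.subset[OF K] by simp
    also have "\<dots> \<longleftrightarrow> k \<in> K"
      using rcos_inv_eq_iff[OF K k one_closed] k by simp
    finally show ?thesis .
  qed
  have "{\<sigma> \<in> actions G X. finite_orbits G X \<sigma>} \<inter> cylinder G X \<phi> (insert g S) {x} \<noteq> {}"
    using dense \<phi> S g x(1) X0 by (subst (asm) dense_in_action_topology_iff) auto
  then obtain \<sigma> where \<sigma>: "\<sigma> \<in> actions G X" "finite_orbits G X \<sigma>"
    and near: "\<And>s. s \<in> insert g S \<Longrightarrow> \<sigma> s x = \<phi> s x"
    unfolding cylinder_def by auto
  have "x \<in> X"
    using x(1) X0 by blast
  let ?L = "stabilizer G \<sigma> x"
  have L: "fin_index_subgroup G ?L"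
    using \<sigma> \<open>x \<in> X\<close> by (intro fin_index_stabilizer_of_finite_orbit) (auto simp: orbits_def)
  have "S \<subseteq> K"
    unfolding S(3) by (auto intro: generate.incl)
  then have "\<sigma> s x = x \<and> s \<in> carrier G" if "s \<in> S" for s
    using that S(2) near[of s] fixes_iff[of s] by auto
  then have "S \<subseteq> ?L"
    by (auto simp: stabilizer_def)
  then have "K \<subseteq> ?L"
    unfolding S(3) using L by (intro generate_subgroup_incl) (simp_all add: fin_index_subgroup_def)
  moreover have "g \<notin> ?L"
    using near[of g] fixes_iff[of g] g by (simp add: stabilizer_def)
  ultimately show "\<exists>L. fin_index_subgroup G L \<and> K \<subseteq> L \<and> g \<notin> L"
    using L by blast
qed

section \<open>Generic actions\<close>

lemma dense_in_action_topology_mono: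
  assumes "dense_in (action_topology G X) D" "D \<subseteq> E" "E \<subseteq> actions G X"
  shows "dense_in (action_topology G X) E"
  using assms closure_of_mono[OF assms(2), of "action_topology G X"]
    closure_of_subset_topspace[of "action_topology G X" E]
  by (auto simp: dense_in_def topspace_action_topology)

text \<open>Finiteness of \<open>Y\<close> takes care of inverses: a generator maps \<open>Y\<close> injectively into itself, hence
  onto itself.\<close>

lemma generate_invariant:
  assumes \<sigma>: "\<sigma> \<in> actions G X" and "S \<subseteq> carrier G" and Y: "finite Y" "Y \<subseteq> X"
    and inv: "\<And>s y. \<lbrakk>s \<in> S; y \<in> Y\<rbrakk> \<Longrightarrow> \<sigma> s y \<in> Y"
    and "g \<in> generate G S" "y \<in> Y"
  shows "\<sigma> g y \<in> Y"
  using assms(6,7)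
proof (induction arbitrary: y)
  case one
  then show ?case
    using actions_one[OF is_group \<sigma>] Y by auto
next
  case (incl s)
  then show ?case
    using inv by simp
next
  case (inv s)
  then have s: "s \<in> carrier G"
    using assms(2) by blast
  have "inj_on (\<sigma> s) Y"
    using actions_inj[OF is_group \<sigma> s] Y(2) by (auto simp: inj_on_def)
  then have "\<sigma> s ` Y = Y"
    using assms(5) inv(1) Y(1) by (intro endo_inj_surj) auto
  then obtain z where "z \<in> Y" "y = \<sigma> s z"
    using inv(2) by blast
  then show ?case
    using actions_inv_cancel[OF is_group \<sigma> s] Y(2) by auto
next
  case (eng g k)
  then show ?case
    using actions_mult[OF is_group \<sigma>, of g k y] generate_in_carrier[OF assms(2)] Y(2) by auto
qed

text \<open>An action that agrees with \<open>\<sigma>\<close> for the generators \<open>S\<close> on a finite orbit of \<open>\<langle>S\<rangle>\<close> leaves that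
  orbit invariant, so finiteness of the orbit persists on a cylinder.\<close>

lemma openin_finite_generate_orbit:
  assumes S: "finite S" "S \<subseteq> carrier G" and x: "x \<in> X"
  shows "openin (action_topology G X)
    {\<sigma> \<in> actions G X. finite (orbit (G\<lparr>carrier := generate G S\<rparr>) \<sigma> x)}" (is "openin _ ?U")
proof (subst openin_subopen, intro ballI exI conjI)
  fix \<sigma> assume "\<sigma> \<in> ?U"
  then have \<sigma>: "\<sigma> \<in> actions G X" and fin: "finite (orbit (G\<lparr>carrier := generate G S\<rparr>) \<sigma> x)"
    by auto
  let ?O = "orbit (G\<lparr>carrier := generate G S\<rparr>) \<sigma> x"
  have gen: "generate G S \<subseteq> carrier G"
    using generate_incl[OF S(2)] .
  have OX: "?O \<subseteq> X"
    using gen actions_closed[OF is_group \<sigma>] x by (auto simp: orbit_def)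
  show "openin (action_topology G X) (cylinder G X \<sigma> S ?O)"
    using S fin OX by (rule openin_cylinder)
  show "\<sigma> \<in> cylinder G X \<sigma> S ?O"
    using \<sigma> by (simp add: cylinder_def)
  show "cylinder G X \<sigma> S ?O \<subseteq> ?U"
  proof
    fix \<tau> assume "\<tau> \<in> cylinder G X \<sigma> S ?O"
    then have \<tau>: "\<tau> \<in> actions G X" and agree: "\<And>s y. \<lbrakk>s \<in> S; y \<in> ?O\<rbrakk> \<Longrightarrow> \<tau> s y = \<sigma> s y"
      by (auto simp: cylinder_def)
    have "\<sigma> \<one> x \<in> ?O"
      using generate.one[of G S] by (auto simp: orbit_def)
    then have "x \<in> ?O"
      using actions_one[OF is_group \<sigma> x] by simp
    have "\<tau> s y \<in> ?O" if s: "s \<in> S" and y: "y \<in> ?O" for s y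
    proof -
      obtain g where g: "g \<in> generate G S" "y = \<sigma> g x"
        using y by (auto simp: orbit_def)
      have "s \<in> carrier G" "g \<in> carrier G"
        using s S(2) g(1) gen by blast+
      then have "\<tau> s y = \<sigma> (s \<otimes> g) x"
        using agree[OF s y] actions_mult[OF is_group \<sigma> _ _ x, of s g] g(2) by simp
      moreover have "s \<otimes> g \<in> generate G S"
        by (rule generate.eng[OF generate.incl[OF s] g(1)])
      ultimately show ?thesis
        by (auto simp: orbit_def)
    qed
    then have "orbit (G\<lparr>carrier := generate G S\<rparr>) \<tau> x \<subseteq> ?O"
      using generate_invariant[OF \<tau> S(2) fin OX _ _ \<open>x \<in> ?O\<close>] unfolding orbit_def[of _ \<tau>] by auto
    then show "\<tau> \<in> ?U"
      using \<tau> fin finite_subset by blast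
  qed
qed

text \<open>There are countably many pairs of a finite set \<open>S\<close> of generators and a point \<open>x\<close>. For each, the
  actions in which the orbit of \<open>x\<close> under \<open>\<langle>S\<rangle>\<close> is finite form an open set, which is dense because it
  contains all actions with finite orbits.\<close>

theorem generic_finite_orbits_on_fin_gen:
  assumes "countable X" "countable (carrier G)"
    and dense: "dense_in (action_topology G X) {\<sigma> \<in> actions G X. finite_orbits G X \<sigma>}"
  shows "generically (action_topology G X)
    (\<lambda>\<sigma>. \<forall>H. fin_gen_subgroup G H \<longrightarrow> finite_orbits_on G X H \<sigma>)"
proof -
  define U where "U = (\<lambda>(S, x). {\<sigma> \<in> actions G X. finite (orbit (G\<lparr>carrier := generate G S\<rparr>) \<sigma> x)})"
  define \<U> where "\<U> = U ` ({S. finite S \<and> S \<subseteq> carrier G} \<times> X)"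
  have "countable \<U>"
    unfolding \<U>_def using assms(1,2) by (intro countable_image countable_SIGMA countable_Collect_finite_subset)
  moreover have "openin (action_topology G X) W \<and> dense_in (action_topology G X) W" if W: "W \<in> \<U>" for W
  proof -
    obtain S x where S: "finite S" "S \<subseteq> carrier G" and x: "x \<in> X" and W: "W = U (S, x)"
      using W unfolding \<U>_def by blast
    have "{\<sigma> \<in> actions G X. finite_orbits G X \<sigma>} \<subseteq> W"
    proof
      fix \<sigma> assume "\<sigma> \<in> {\<sigma> \<in> actions G X. finite_orbits G X \<sigma>}"
      then have "\<sigma> \<in> actions G X" "finite (orbit G \<sigma> x)"
        using x by (auto simp: orbits_def)
      moreover have "orbit (G\<lparr>carrier := generate G S\<rparr>) \<sigma> x \<subseteq> orbit G \<sigma> x"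
        using generate_incl[OF S(2)] by (auto simp: orbit_def)
      ultimately show "\<sigma> \<in> W"
        unfolding W U_def using finite_subset by auto
    qed
    moreover have "W \<subseteq> actions G X"
      by (auto simp: W U_def)
    ultimately show ?thesis
      using dense_in_action_topology_mono[OF dense] openin_finite_generate_orbit[OF S x]
      by (simp add: W U_def)
  qed
  ultimately have "generic_in (action_topology G X) (actions G X \<inter> \<Inter>\<U>)"
    unfolding generic_in_def topspace_action_topology by blast
  moreover have "finite_orbits_on G X H \<sigma>" if \<sigma>: "\<sigma> \<in> actions G X \<inter> \<Inter>\<U>" and H: "fin_gen_subgroup G H" for \<sigma> H
  proof -
    obtain S where S: "finite S" "S \<subseteq> carrier G" "H = generate G S"
      using H unfolding fin_gen_subgroup_def by blast
    have "finite (orbit (G\<lparr>carrier := H\<rparr>) \<sigma> x)" if "x \<in> X" for x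
    proof -
      have "U (S, x) \<in> \<U>"
        unfolding \<U>_def using S that by (intro imageI) simp
      then have "\<sigma> \<in> U (S, x)"
        using \<sigma> by blast
      then show ?thesis
        by (simp add: U_def S(3))
    qed
    then show ?thesis
      by (auto simp: finite_orbits_on_def orbits_def)
  qed
  ultimately show ?thesis
    unfolding generically_def by blast
qed

lemma generically_imp_dense:
  assumes "countable X" "X \<noteq> {}" "countable (carrier G)"
    and "generically (action_topology G X) P"
  shows "dense_in (action_topology G X) {\<sigma> \<in> actions G X. P \<sigma>}"
proof -
  obtain A \<U> where A: "A \<subseteq> actions G X" "\<forall>\<sigma>\<in>A. P \<sigma>" and "countable \<U>"
    and \<U>: "\<And>U. U \<in> \<U> \<Longrightarrow> openin (action_topology G X) U \<and> dense_in (action_topology G X) U"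
    and sub: "actions G X \<inter> \<Inter>\<U> \<subseteq> A"
    using assms(4) unfolding generically_def generic_in_def topspace_action_topology
    by (elim exE conjE) (metis (no_types))
  have "dense_in (action_topology G X) (actions G X \<inter> \<Inter>\<U>)"
    using Baire_actions[OF assms(1-3) \<open>countable \<U>\<close> \<U>] .
  then show ?thesis
    by (rule dense_in_action_topology_mono) (use A sub in auto)
qed

end

theorem theorem1p1:
  fixes X :: "'x set" and G :: "('g, 'b) monoid_scheme"
  assumes "countable X" and "infinite X"
    and "group G" and "countable (carrier G)" and "infinite (carrier G)"
  shows
    "(fin_gen_group G \<longrightarrow>
        (LERF G \<longleftrightarrow> dense_in (chabauty G) {K. fin_index_subgroup G K}) \<and>
        (LERF G \<longleftrightarrow> generically (action_topology G X) (\<lambda>\<sigma>. finite_orbits G X \<sigma>)))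
     \<and>
     ((LERF G \<longleftrightarrow> dense_in (chabauty G) {K. fin_index_subgroup G K}) \<and>
      (LERF G \<longleftrightarrow>
        dense_in (action_topology G X) {\<sigma> \<in> actions G X. finite_orbits G X \<sigma>}) \<and>
      (LERF G \<longrightarrow>
        generically (action_topology G X)
          (\<lambda>\<sigma>. \<forall>H. fin_gen_subgroup G H \<longrightarrow> finite_orbits_on G X H \<sigma>)))"
proof -
  interpret group G by fact
  have chabauty: "LERF G \<longleftrightarrow> dense_in (chabauty G) {K. fin_index_subgroup G K}"
    by (rule LERF_iff_dense_fin_index)
  have dense: "LERF G \<longleftrightarrow> dense_in (action_topology G X) {\<sigma> \<in> actions G X. finite_orbits G X \<sigma>}"
    unfolding chabauty using dense_fin_index_imp_dense_finite_orbits[OF assms(2)]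
      dense_finite_orbits_imp_LERF[OF assms(2,4), unfolded chabauty] by (intro iffI)
  have generic: "generically (action_topology G X)
      (\<lambda>\<sigma>. \<forall>H. fin_gen_subgroup G H \<longrightarrow> finite_orbits_on G X H \<sigma>)" if "LERF G"
    using that unfolding dense by (rule generic_finite_orbits_on_fin_gen[OF assms(1,4)])
  have "LERF G \<longleftrightarrow> generically (action_topology G X) (\<lambda>\<sigma>. finite_orbits G X \<sigma>)"
    if "fin_gen_group G"
  proof
    assume "LERF G"
    have "fin_gen_subgroup G (carrier G)"
      using that by (simp add: fin_gen_group_def)
    moreover have "finite_orbits_on G X (carrier G) \<sigma> \<longleftrightarrow> finite_orbits G X \<sigma>" for \<sigma>
      by (simp add: finite_orbits_on_def)
    ultimately show "generically (action_topology G X) (\<lambda>\<sigma>. finite_orbits G X \<sigma>)"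
      using generic[OF \<open>LERF G\<close>] unfolding generically_def by (metis (no_types, lifting))
  next
    assume "generically (action_topology G X) (\<lambda>\<sigma>. finite_orbits G X \<sigma>)"
    then show "LERF G"
      using generically_imp_dense[OF assms(1) _ assms(4)] assms(2) dense by auto
  qed
  with chabauty dense generic show ?thesis
    by (intro conjI impI) simp_all
qed

end
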